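(* Let $X=Y=[1,\infty)$ with the usual metric, let $g\colon Y\to Y$ be given by $g(x)=x^2$, and for every integer $k\ge 1$ let $f_k\colon X\to X$ be given by $f_k(x)=\lceil x^{2^k}\rceil^{2^{-k+1}}$. Then for every integer $k\ge 1$: (1) for every $n\in\{1,\ldots,k\}$ the maps $f_k^n$ and $g^n$ are coarsely conjugate via the identity maps (i.e. with $\varphi=\psi=\mathrm{id}$); (2) for every integer $n>k$, there is no coarse equivalence $\psi\colon Y\to X$ such that $\psi\circ g^n$ and $f_k^n\circ\psi$ are close; in particular, $f_k^n$ and $g^n$ are not coarsely conjugate.
   Context: Here $f^n$ denotes the $n$-fold iterate of $f$. Let $(X,d_X)$ and $(Y,d_Y)$ be metric spaces. Two maps $a,b$ from a set $S$ to $Y$ are close if $\sup_{x\in S} d_Y(a(x),b(x))<\infty$. A map $\varphi\colon X\to Y$ is controlled if there exists a non-decreasing function $\rho\colon[0,\infty)\to[0,\infty)$ such that $d_Y(\varphi(x),\varphi(x'))\le\rho(d_X(x,x'))$ for all $x,x'\in X$. A controlled map $\varphi\colon X\to Y$ is a coarse equivalence if it admits a coarse inverse, that is, a controlled map $\psi\colon Y\to X$ such that $\varphi\circ\psi$ and $\psi\circ\varphi$ are close to the respective identity maps. Maps $f\colon X\to X$ and $g\colon Y\to Y$ are coarsely conjugate (via $\varphi$ and $\psi$) if there exists a coarse equivalence $\varphi\colon X\to Y$ with a coarse inverse $\psi\colon Y\to X$ such that $\varphi\circ f$ is close to $g\circ\varphi$ and $\psi\circ g$ is close to $f\circ\psi$.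 *)

theory Defs
  imports Complex_Main "HOL-Library.FuncSet"
begin

text \<open>
  Metric spaces are given as subsets \<open>X :: 'a set\<close> of a type of class
  \<^class>\<open>metric_space\<close>, with the restriction of \<^const>\<open>dist\<close> as their metric.  A map
  \<open>X \<rightarrow> Y\<close> is a total HOL function; all the notions below depend only on its values on \<open>X\<close>.
\<close>

text \<open>The supremum of the distances is finite iff the set of distances is bounded above.\<close>

definition close_maps :: "'s set \<Rightarrow> ('s \<Rightarrow> 'b::metric_space) \<Rightarrow> ('s \<Rightarrow> 'b) \<Rightarrow> bool" where
  "close_maps S a b \<longleftrightarrow> bdd_above ((\<lambda>x. dist (a x) (b x)) ` S)"

definition controlled ::
    "'a::metric_space set \<Rightarrow> 'b::metric_space set \<Rightarrow> ('a \<Rightarrow> 'b) \<Rightarrow> bool" where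
  "controlled X Y \<phi> \<longleftrightarrow>
     \<phi> \<in> X \<rightarrow> Y \<and>
     (\<exists>\<rho> :: real \<Rightarrow> real. \<rho> \<in> {0..} \<rightarrow> {0..} \<and> mono_on {0..} \<rho> \<and>
        (\<forall>x\<in>X. \<forall>x'\<in>X. dist (\<phi> x) (\<phi> x') \<le> \<rho> (dist x x')))"

definition coarse_inverse ::
    "'a::metric_space set \<Rightarrow> 'b::metric_space set \<Rightarrow> ('a \<Rightarrow> 'b) \<Rightarrow> ('b \<Rightarrow> 'a) \<Rightarrow> bool" where
  "coarse_inverse X Y \<phi> \<psi> \<longleftrightarrow>
     controlled Y X \<psi> \<and> close_maps Y (\<phi> \<circ> \<psi>) id \<and> close_maps X (\<psi> \<circ> \<phi>) id"

definition coarse_equivalence ::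
    "'a::metric_space set \<Rightarrow> 'b::metric_space set \<Rightarrow> ('a \<Rightarrow> 'b) \<Rightarrow> bool" where
  "coarse_equivalence X Y \<phi> \<longleftrightarrow> controlled X Y \<phi> \<and> (\<exists>\<psi>. coarse_inverse X Y \<phi> \<psi>)"

text \<open>
  The next two notions are meant for \<open>f \<in> X \<rightarrow> X\<close> and \<open>g \<in> Y \<rightarrow> Y\<close>; these conditions are not
  part of the definitions.
\<close>

definition coarsely_conjugate_via ::
    "'a::metric_space set \<Rightarrow> ('a \<Rightarrow> 'a) \<Rightarrow> 'b::metric_space set \<Rightarrow> ('b \<Rightarrow> 'b) \<Rightarrow>
     ('a \<Rightarrow> 'b) \<Rightarrow> ('b \<Rightarrow> 'a) \<Rightarrow> bool" where
  "coarsely_conjugate_via X f Y g \<phi> \<psi> \<longleftrightarrow>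
     coarse_equivalence X Y \<phi> \<and> coarse_inverse X Y \<phi> \<psi> \<and>
     close_maps X (\<phi> \<circ> f) (g \<circ> \<phi>) \<and> close_maps Y (\<psi> \<circ> g) (f \<circ> \<psi>)"

definition coarsely_conjugate ::
    "'a::metric_space set \<Rightarrow> ('a \<Rightarrow> 'a) \<Rightarrow> 'b::metric_space set \<Rightarrow> ('b \<Rightarrow> 'b) \<Rightarrow> bool" where
  "coarsely_conjugate X f Y g \<longleftrightarrow> (\<exists>\<phi> \<psi>. coarsely_conjugate_via X f Y g \<phi> \<psi>)"

definition sq_map :: "real \<Rightarrow> real" where
  "sq_map x = x ^ 2"

definition ceil_map :: "nat \<Rightarrow> real \<Rightarrow> real" where
  "ceil_map k x = real_of_int \<lceil>x ^ (2 ^ k)\<rceil> powr (2 powr (- real k + 1))"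

lemma sq_map_funcset: "sq_map \<in> {1..} \<rightarrow> {1..}"
  by (auto simp: sq_map_def)

lemma ceil_map_funcset: "ceil_map k \<in> {1..} \<rightarrow> {1..}"
proof
  fix x :: real assume "x \<in> {1..}"
  then have "1 \<le> x ^ (2 ^ k)" by simp
  then have "1 \<le> real_of_int \<lceil>x ^ (2 ^ k)\<rceil>" by linarith
  then show "ceil_map k x \<in> {1..}"
    by (simp add: ceil_map_def ge_one_powr_ge_zero)
qed

end

theory Submission
  imports Defs
begin

text \<open>
  Write \<open>f\<^sub>k\<close> for \<^term>\<open>ceil_map k\<close> and \<open>g\<close> for \<^term>\<open>sq_map\<close>.  Conjugating \<open>f\<^sub>k\<close> by \<open>x \<mapsto> x\<^bsup>2^k\<^esup>\<close> gives the map \<open>u \<mapsto> \<lceil>u\<rceil>\<^sup>2\<close>, which takes integers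
  to integers.  Only the first rounding therefore has an effect, and for \<open>n \<ge> 1\<close> the \<open>n\<close>-th iterate
  is \<open>x \<mapsto> \<lceil>x\<^bsup>2^k\<^esup>\<rceil>\<^bsup>a\<^esup>\<close> with \<open>a = 2\<^bsup>n-k\<^esup>\<close> (lemma \<open>ceil_map_funpow\<close>), while the \<open>n\<close>-th iterate of
  squaring is \<open>x \<mapsto> (x\<^bsup>2^k\<^esup>)\<^bsup>a\<^esup>\<close>.

  If \<open>n \<le> k\<close>, then \<open>a \<le> 1\<close>, and \<open>u \<mapsto> u\<^bsup>a\<^esup>\<close> does not increase distances on \<open>[1,\<infinity>)\<close>
  (lemma \<open>powr_diff_le\<close>), so the two iterates differ by at most \<open>1\<close>.

  If \<open>n > k\<close>, then \<open>a\<close> is an integer \<open>m \<ge> 2\<close>, so all values of the \<open>n\<close>-th iterate are \<open>m\<close>-th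
  powers of natural numbers.  A coarse equivalence \<open>\<psi>\<close> has coarsely dense image, and that image
  equals the image of \<open>\<psi> \<circ> g\<^bsup>n\<^esup>\<close>, because \<open>g\<^bsup>n\<^esup>\<close> maps \<open>[1,\<infinity>)\<close> onto itself.  If \<open>\<psi> \<circ> g\<^bsup>n\<^esup>\<close> were
  close to \<open>f\<^sub>k\<^bsup>n\<^esup> \<circ> \<psi>\<close>, the \<open>m\<close>-th powers would be coarsely dense in \<open>[1,\<infinity>)\<close>; but the gaps
  between consecutive \<open>m\<close>-th powers are unbounded (lemma \<open>ex_far_from_powers\<close>).
\<close>

lemma close_mapsI:
  assumes "\<And>x. x \<in> S \<Longrightarrow> dist (a x) (b x) \<le> C"
  shows "close_maps S a b"
  unfolding close_maps_def using assms by (intro bdd_aboveI2)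

lemma close_mapsE:
  assumes "close_maps S a b"
  obtains C where "\<And>x. x \<in> S \<Longrightarrow> dist (a x) (b x) \<le> C"
  using assms unfolding close_maps_def bdd_above_def by auto

lemma controlled_id: "controlled X X id"
  unfolding controlled_def
  by (intro conjI exI[of _ "\<lambda>t. t"]) (auto simp: mono_on_def)

lemma coarse_inverse_id: "coarse_inverse X X id id"
  unfolding coarse_inverse_def by (auto intro!: controlled_id close_mapsI[where C = 0])

lemma coarse_equivalence_coarse_inverse:
  assumes "coarse_equivalence X Y \<phi>" "coarse_inverse X Y \<phi> \<psi>"
  shows "coarse_equivalence Y X \<psi>"
  using assms unfolding coarse_equivalence_def coarse_inverse_def by auto

lemma coarse_equivalence_coarsely_dense:
  assumes "coarse_equivalence Y X \<psi>"
  obtains C where "\<And>x. x \<in> X \<Longrightarrow> \<exists>y\<in>Y. dist (\<psi> y) x \<le> C"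
proof -
  from assms obtain \<phi> where "controlled X Y \<phi>" and close: "close_maps X (\<psi> \<circ> \<phi>) id"
    unfolding coarse_equivalence_def coarse_inverse_def by auto
  then have "\<phi> \<in> X \<rightarrow> Y" by (simp add: controlled_def)
  moreover from close obtain C where "\<And>x. x \<in> X \<Longrightarrow> dist ((\<psi> \<circ> \<phi>) x) (id x) \<le> C"
    by (rule close_mapsE) blast
  ultimately show thesis by (intro that) force
qed

lemma sq_map_funpow: "(sq_map ^^ n) x = x ^ (2 ^ n)"
  by (induction n) (simp_all add: sq_map_def power_mult[symmetric] mult.commute)

lemma sq_map_funpow_surj:
  assumes "y \<ge> 1"
  obtains x where "x \<ge> 1" "(sq_map ^^ n) x = y"
  using assms by (intro that[of "root (2 ^ n) y"]) (simp_all add: sq_map_funpow)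

lemma ceil_map_funpow:
  assumes "x \<ge> 1" "n \<ge> 1"
  shows "(ceil_map k ^^ n) x = real_of_int \<lceil>x ^ (2 ^ k)\<rceil> powr (2 powr (real n - real k))"
  using assms(2)
proof (induction n rule: dec_induct)
  case base
  show ?case by (simp add: ceil_map_def)
next
  case (step n)
  define c where "c = \<lceil>x ^ (2 ^ k)\<rceil>"
  have "1 \<le> x ^ (2 ^ k)" using assms(1) by simp
  then have c: "c \<ge> 1" unfolding c_def by linarith
  have "(real_of_int c powr (2 powr (real n - real k))) ^ (2 ^ k)
      = real_of_int c powr (2 powr (real n - real k) * 2 powr real k)"
    using c by (simp add: powr_powr powr_realpow[symmetric])
  also have "2 powr (real n - real k) * 2 powr real k = real (2 ^ n)"
    by (simp only: powr_add[symmetric]) (simp add: powr_realpow)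
  also have "real_of_int c powr real (2 ^ n) = real_of_int (c ^ (2 ^ n))"
    using c by (subst powr_realpow) auto
  \<comment> \<open>The \<open>2\<^bsup>k\<^esup>\<close>-th power of an iterate is an integer, so rounding it up does nothing.\<close>
  finally have "ceil_map k (real_of_int c powr (2 powr (real n - real k)))
      = real_of_int (c ^ (2 ^ n)) powr (2 powr (- real k + 1))"
    by (simp only: ceil_map_def ceiling_of_int)
  also have "real_of_int (c ^ (2 ^ n)) = real_of_int c powr (2 powr real n)"
    using c by (simp add: powr_realpow[symmetric])
  also have "\<dots> powr (2 powr (- real k + 1)) = real_of_int c powr (2 powr (real (Suc n) - real k))"
    by (simp add: powr_powr powr_add[symmetric] algebra_simps)
  finally show ?case using step by (simp add: c_def)
qed

lemma powr_diff_le: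
  fixes u v a :: real
  assumes "1 \<le> u" "u \<le> v" "a \<le> 1"
  shows "v powr a - u powr a \<le> v - u"
proof -
  have "(v / u) powr a \<le> (v / u) powr 1"
    using assms by (intro powr_mono) auto
  then have "u powr a * (v / u) powr a \<le> u powr a * (v / u)"
    using assms by (intro mult_left_mono) auto
  moreover have "u powr a * (v / u) powr a = v powr a"
    using assms by (simp add: powr_divide)
  moreover have "u powr a * (v / u) - u powr a = u powr (a - 1) * (v - u)"
    using assms by (simp add: powr_diff field_simps)
  moreover have "u powr (a - 1) * (v - u) \<le> 1 * (v - u)"
  proof (intro mult_right_mono)
    have "u powr (a - 1) \<le> u powr 0" using assms by (intro powr_mono) auto
    then show "u powr (a - 1) \<le> 1" using assms by simp
  qed (use assms in simp)
  ultimately show ?thesis by (metis diff_right_mono mult_1 order_trans)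
qed

text \<open>The point in question is the midpoint of a large gap \<open>[j\<^bsup>m\<^esup>, (j + 1)\<^bsup>m\<^esup>]\<close>.\<close>

lemma ex_far_from_powers:
  fixes D :: real
  assumes "m \<ge> 2"
  obtains x where "x \<ge> 1" "\<And>i::nat. dist (real i ^ m) x > D"
proof -
  obtain j0 :: nat where j0: "D < real j0" using reals_Archimedean2 by blast
  define j where "j = Suc j0"
  have j: "D < real j" "real j \<ge> 1" using j0 by (simp_all add: j_def)
  obtain l where m: "m = Suc (Suc l)"
    using assms by (metis add_2_eq_Suc le_Suc_ex)
  have gap: "real j ^ m + 2 * real j \<le> (real j + 1) ^ m"
  proof -
    have l: "real j ^ l \<le> (real j + 1) ^ l" "1 \<le> (real j + 1) ^ l"
      using j by (auto intro: power_mono)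
    have "real j ^ m + 2 * real j = real j ^ l * (real j)\<^sup>2 + 2 * real j * 1"
      by (simp add: m power2_eq_square algebra_simps)
    also have "\<dots> \<le> (real j + 1) ^ l * (real j)\<^sup>2 + 2 * real j * (real j + 1) ^ l"
      using l j by (intro add_mono mult_right_mono mult_left_mono) auto
    also have "\<dots> \<le> (real j + 1) ^ l * (real j + 1)\<^sup>2"
      using l by (simp add: power2_eq_square algebra_simps)
    also have "\<dots> = (real j + 1) ^ m" by (simp add: m power2_eq_square algebra_simps)
    finally show ?thesis .
  qed
  define x where "x = (real j ^ m + (real j + 1) ^ m) / 2"
  have x: "real j ^ m + real j \<le> x" "x + real j \<le> (real j + 1) ^ m"
    using gap by (simp_all add: x_def field_simps)
  show thesis
  proof (rule that)
    have "0 \<le> real j ^ m" by simp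
    then show "x \<ge> 1" using x j by linarith
    fix i :: nat
    consider "i \<le> j" | "i \<ge> j + 1" by linarith
    then show "dist (real i ^ m) x > D"
    proof cases
      case 1
      then have "real i ^ m \<le> real j ^ m" by (intro power_mono) auto
      then show ?thesis using x j by (simp add: dist_real_def)
    next
      case 2
      then have "(real j + 1) ^ m \<le> real i ^ m" by (intro power_mono) auto
      then show ?thesis using x j by (simp add: dist_real_def)
    qed
  qed
qed

lemma close_ceil_map_sq_map_funpow:
  assumes "1 \<le> n" "n \<le> k"
  shows "close_maps {1..} (ceil_map k ^^ n) (sq_map ^^ n)"
proof (rule close_mapsI)
  fix x :: real assume "x \<in> {1..}"
  then have x: "x \<ge> 1" by simp
  define u where "u = x ^ (2 ^ k)"
  define a :: real where "a = 2 powr (real n - real k)"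
  have u: "1 \<le> u" "u \<le> real_of_int \<lceil>u\<rceil>" "real_of_int \<lceil>u\<rceil> - u \<le> 1"
    using x by (simp_all add: u_def) linarith
  have "a \<le> 2 powr 0" unfolding a_def using assms by (intro powr_mono) auto
  then have a: "a \<le> 1" "a \<ge> 0" by (simp_all add: a_def)
  have "u powr a = x powr (2 powr real k * 2 powr (real n - real k))"
    using x by (simp add: u_def a_def powr_realpow[symmetric] powr_powr)
  also have "\<dots> = x ^ (2 ^ n)"
    using x by (simp add: powr_add[symmetric] powr_realpow[symmetric])
  finally have "u powr a = (sq_map ^^ n) x" by (simp add: sq_map_funpow)
  moreover have "(ceil_map k ^^ n) x = real_of_int \<lceil>u\<rceil> powr a"
    using ceil_map_funpow[OF x assms(1)] by (simp add: u_def a_def)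
  moreover have "u powr a \<le> real_of_int \<lceil>u\<rceil> powr a"
    using u a by (intro powr_mono2) auto
  moreover have "real_of_int \<lceil>u\<rceil> powr a - u powr a \<le> 1"
    using powr_diff_le[of u "real_of_int \<lceil>u\<rceil>" a] u a by linarith
  ultimately show "dist ((ceil_map k ^^ n) x) ((sq_map ^^ n) x) \<le> 1"
    by (simp add: dist_real_def)
qed

lemma ceil_map_funpow_power_of_nat:
  assumes "x \<ge> 1" "k < n"
  obtains i :: nat where "(ceil_map k ^^ n) x = real i ^ (2 ^ (n - k))"
proof -
  have x: "1 \<le> x ^ (2 ^ k)" using assms(1) by simp
  then have pos: "0 < nat \<lceil>x ^ (2 ^ k)\<rceil>" by linarith
  have "(2::real) powr (real n - real k) = real (2 ^ (n - k))"
    using assms(2) by (simp add: powr_realpow[symmetric] of_nat_diff)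
  then have "(ceil_map k ^^ n) x = real (nat \<lceil>x ^ (2 ^ k)\<rceil>) powr real (2 ^ (n - k))"
    using ceil_map_funpow[of x n k] assms pos by simp
  also have "\<dots> = real (nat \<lceil>x ^ (2 ^ k)\<rceil>) ^ (2 ^ (n - k))"
    using pos by (intro powr_realpow) simp
  finally show thesis by (rule that)
qed

lemma not_close_ceil_map_sq_map_funpow:
  assumes "k < n" "coarse_equivalence {1..} {1..} \<psi>"
  shows "\<not> close_maps {1..} (\<psi> \<circ> (sq_map ^^ n)) ((ceil_map k ^^ n) \<circ> \<psi>)"
proof
  assume "close_maps {1..} (\<psi> \<circ> (sq_map ^^ n)) ((ceil_map k ^^ n) \<circ> \<psi>)"
  then obtain C where
    C: "\<And>z. z \<in> {1..} \<Longrightarrow> dist ((\<psi> \<circ> (sq_map ^^ n)) z) (((ceil_map k ^^ n) \<circ> \<psi>) z) \<le> C"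
    by (rule close_mapsE) blast
  obtain C' where C': "\<And>x. x \<in> {1..} \<Longrightarrow> \<exists>y\<in>{1..}. dist (\<psi> y) x \<le> C'"
    using coarse_equivalence_coarsely_dense[OF assms(2)] by blast
  have \<psi>: "\<psi> \<in> {1..} \<rightarrow> {1..}"
    using assms(2) by (simp add: coarse_equivalence_def controlled_def)
  have "(2::nat) ^ 1 \<le> 2 ^ (n - k)" using assms(1) by (intro power_increasing) auto
  then obtain x where x: "x \<ge> 1" "\<And>i::nat. dist (real i ^ (2 ^ (n - k))) x > C + C'"
    by (metis ex_far_from_powers power_one_right)
  obtain y where y: "y \<ge> 1" "dist (\<psi> y) x \<le> C'" using C'[of x] x by auto
  obtain z where z: "z \<ge> 1" "(sq_map ^^ n) z = y" using sq_map_funpow_surj[OF y(1)] by blast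
  have "\<psi> z \<ge> 1" using \<psi> z by auto
  then obtain i :: nat where i: "(ceil_map k ^^ n) (\<psi> z) = real i ^ (2 ^ (n - k))"
    using ceil_map_funpow_power_of_nat assms(1) by blast
  have "dist (\<psi> y) (real i ^ (2 ^ (n - k))) \<le> C" using C[of z] z i by simp
  then have "dist (real i ^ (2 ^ (n - k))) x \<le> C + C'"
    using y(2) dist_triangle3[of "real i ^ (2 ^ (n - k))" x "\<psi> y"] by linarith
  then show False using x(2)[of i] by linarith
qed

theorem theorem2p2:
  fixes X Y :: "real set" and k :: nat
  assumes "X = {1..}" and "Y = {1..}" and "k \<ge> 1"
  shows "(\<forall>n\<in>{1..k}. coarsely_conjugate_via X (ceil_map k ^^ n) Y (sq_map ^^ n) id id) \<and>
         (\<forall>n>k. (\<nexists>\<psi>. coarse_equivalence Y X \<psi> \<and>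
                      close_maps Y (\<psi> \<circ> (sq_map ^^ n)) ((ceil_map k ^^ n) \<circ> \<psi>)) \<and>
                \<not> coarsely_conjugate X (ceil_map k ^^ n) Y (sq_map ^^ n))"
proof (intro conjI ballI allI impI)
  fix n assume "n \<in> {1..k}"
  then have close: "close_maps {1..} (ceil_map k ^^ n) (sq_map ^^ n)"
    by (simp add: close_ceil_map_sq_map_funpow)
  moreover from close have "close_maps {1..} (sq_map ^^ n) (ceil_map k ^^ n)"
    by (simp add: close_maps_def dist_commute)
  ultimately show "coarsely_conjugate_via X (ceil_map k ^^ n) Y (sq_map ^^ n) id id"
    using assms controlled_id coarse_inverse_id
    by (auto simp: coarsely_conjugate_via_def coarse_equivalence_def)
next
  fix n assume n: "k < n"
  show none: "\<nexists>\<psi>. coarse_equivalence Y X \<psi> \<and>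
      close_maps Y (\<psi> \<circ> (sq_map ^^ n)) ((ceil_map k ^^ n) \<circ> \<psi>)"
    using not_close_ceil_map_sq_map_funpow[OF n] assms by blast
  show "\<not> coarsely_conjugate X (ceil_map k ^^ n) Y (sq_map ^^ n)"
    using none coarse_equivalence_coarse_inverse
    unfolding coarsely_conjugate_def coarsely_conjugate_via_def by blast
qed

end
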